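(* For $n \in \mathbb{N}$ (including $n=0$), let $I_n$ be the graph with $n$ vertices and no edges. The only $\chi$-unfrozen graphs among the $I_n$ are $I_0$ and $I_1$; that is, $I_n$ is $\chi$-unfrozen if and only if $n\in\{0,1\}$.
   Context: Graphs are finite, undirected, simple, without loops. $\chi(G)$ is the chromatic number. A nonedge of $G$ is a pair $e=\{u,v\}$ of distinct vertices with $e\notin E(G)$; $G+e$ is $G$ with $e$ added as an edge. $G$ is $\chi$-unfrozen if $\chi(G+e)=\chi(G)$ for every nonedge $e$ of $G$. *)

theory Defs
  imports "Graph_Theory.Pair_Digraph"
begin

text \<open>
  Finite simple undirected graphs are the library's \<open>pair_graph\<close>s: finitely many vertices and
  a symmetric, irreflexive set of arcs on them, so that the undirected edge \<open>{u, v}\<close> is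
  represented by the two arcs \<open>(u, v)\<close> and \<open>(v, u)\<close>.
\<close>

definition edge_set :: "'a pair_pre_digraph \<Rightarrow> 'a set set" where
  "edge_set G = {{u, v} | u v. (u, v) \<in> parcs G}"

definition nonedges :: "'a pair_pre_digraph \<Rightarrow> 'a set set" where
  "nonedges G = {{u, v} | u v. u \<in> pverts G \<and> v \<in> pverts G \<and> u \<noteq> v \<and> {u, v} \<notin> edge_set G}"

definition add_edge :: "'a pair_pre_digraph \<Rightarrow> 'a set \<Rightarrow> 'a pair_pre_digraph" where
  "add_edge G e = G\<lparr>parcs := parcs G \<union> {(u, v). {u, v} = e}\<rparr>"

definition proper_coloring :: "'a pair_pre_digraph \<Rightarrow> nat \<Rightarrow> ('a \<Rightarrow> nat) \<Rightarrow> bool" where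
  "proper_coloring G k c \<longleftrightarrow>
     c ` pverts G \<subseteq> {..<k} \<and> (\<forall>u v. {u, v} \<in> edge_set G \<longrightarrow> c u \<noteq> c v)"

text \<open>
  On a \<open>pair_graph\<close> the minimum below is over a nonempty set, by \<open>ex_proper_coloring\<close>.
\<close>

definition chromatic_number :: "'a pair_pre_digraph \<Rightarrow> nat" where
  "chromatic_number G = (LEAST k. \<exists>c. proper_coloring G k c)"

text \<open>
  Meaningful for \<open>pair_graph\<close>s only; \<open>pair_graph_add_edge\<close> shows that adding a nonedge stays
  within this class.
\<close>

definition chi_unfrozen :: "'a pair_pre_digraph \<Rightarrow> bool" where
  "chi_unfrozen G \<longleftrightarrow>
     (\<forall>e \<in> nonedges G. chromatic_number (add_edge G e) = chromatic_number G)"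

definition edgeless_graph :: "nat \<Rightarrow> nat pair_pre_digraph" where
  "edgeless_graph n = \<lparr>pverts = {..<n}, parcs = {}\<rparr>"

lemma pair_graph_edgeless_graph: "pair_graph (edgeless_graph n)"
  by unfold_locales
    (auto simp: edgeless_graph_def symmetric_def sym_def arcs_ends_def)

lemma edge_set_edgeless_graph: "edge_set (edgeless_graph n) = {}"
  by (simp add: edgeless_graph_def edge_set_def)

lemma edge_set_iff:
  assumes "pair_graph G"
  shows "{u, v} \<in> edge_set G \<longleftrightarrow> (u, v) \<in> parcs G"
proof -
  interpret pair_graph G by fact
  show ?thesis
    using arcs_symmetric by (auto simp: edge_set_def doubleton_eq_iff)
qed

lemma edge_set_add_edge:
  assumes "e \<in> nonedges G"
  shows "edge_set (add_edge G e) = insert e (edge_set G)"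
  using assms by (auto simp: nonedges_def edge_set_def add_edge_def)

lemma pair_graph_add_edge:
  assumes "pair_graph G" and e: "e \<in> nonedges G"
  shows "pair_graph (add_edge G e)"
proof -
  interpret pair_graph G by fact
  from e obtain u v where uv: "e = {u, v}" "u \<in> pverts G" "v \<in> pverts G" "u \<noteq> v"
    by (auto simp: nonedges_def)
  have arcs: "parcs (add_edge G e) = parcs G \<union> {(u, v), (v, u)}"
    using uv by (auto simp: add_edge_def doubleton_eq_iff)
  have verts: "pverts (add_edge G e) = pverts G"
    by (simp add: add_edge_def)
  show ?thesis
    by unfold_locales
      (use uv(2-4) arcs_symmetric in \<open>auto simp: arcs verts symmetric_def sym_def arcs_ends_def
         arc_to_ends_def image_iff pair_finite_verts pair_finite_arcs
         dest: in_arcsD1 in_arcsD2 no_loops'\<close>)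
qed

lemma ex_proper_coloring:
  assumes "pair_graph G"
  shows "\<exists>c. proper_coloring G (card (pverts G)) c"
proof -
  interpret pair_graph G by fact
  obtain c where c: "bij_betw c (pverts G) {0..<card (pverts G)}"
    using ex_bij_betw_finite_nat[OF pair_finite_verts] by blast
  have "c u \<noteq> c v" if "{u, v} \<in> edge_set G" for u v
  proof -
    have uv: "(u, v) \<in> parcs G" using that edge_set_iff[OF assms] by simp
    then have "u \<in> pverts G" "v \<in> pverts G" "u \<noteq> v"
      using in_arcsD1 in_arcsD2 no_loops' by blast+
    then show ?thesis using c by (auto simp: bij_betw_def inj_on_def)
  qed
  then have "proper_coloring G (card (pverts G)) c"
    using c by (auto simp: proper_coloring_def bij_betw_def)
  then show ?thesis by blast
qed

end

theory Submission
  imports Defs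
begin

text \<open>An edgeless graph needs at most one colour, whereas a graph with an edge needs at least
  two. If \<open>n\<close> is at least 2, the pair \<open>{0, 1}\<close> is a nonedge, and adding it
  lifts the chromatic number from at most 1 (\<open>chromatic_number_edgeless_graph_le\<close>) to
  at least 2 (\<open>chromatic_number_add_edge_ge\<close>). If \<open>n\<close> is 0 or 1, there are
  no two distinct vertices, so the condition is vacuous.\<close>

lemma chromatic_number_le:
  assumes "proper_coloring G k c"
  shows "chromatic_number G \<le> k"
  unfolding chromatic_number_def by (rule Least_le) (use assms in blast)

lemma ex_proper_coloring_chromatic_number:
  assumes "pair_graph G"
  shows "\<exists>c. proper_coloring G (chromatic_number G) c"
  unfolding chromatic_number_def by (rule LeastI_ex) (use ex_proper_coloring[OF assms] in blast)

text \<open>An inequality rather than an equation, so that the empty graph, whose chromatic number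
  is 0, needs no separate case.\<close>

lemma chromatic_number_edgeless_graph_le: "chromatic_number (edgeless_graph n) \<le> 1"
proof (rule chromatic_number_le)
  show "proper_coloring (edgeless_graph n) 1 (\<lambda>_. 0)"
    by (auto simp: proper_coloring_def edge_set_edgeless_graph)
qed

text \<open>In an optimal colouring the ends of \<open>e\<close> get distinct colours, and two
  distinct naturals below \<open>k\<close> force \<open>k\<close> \<ge> 2.\<close>

lemma chromatic_number_add_edge_ge:
  assumes G: "pair_graph G" and e: "e \<in> nonedges G"
  shows "chromatic_number (add_edge G e) \<ge> 2"
proof -
  obtain u v where uv: "e = {u, v}" "u \<in> pverts G" "v \<in> pverts G"
    using e by (auto simp: nonedges_def)
  obtain c where "proper_coloring (add_edge G e) (chromatic_number (add_edge G e)) c"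
    using ex_proper_coloring_chromatic_number[OF pair_graph_add_edge[OF G e]] by blast
  then have "c u < chromatic_number (add_edge G e)" "c v < chromatic_number (add_edge G e)"
    "c u \<noteq> c v"
    using uv edge_set_add_edge[OF e] by (auto simp: proper_coloring_def add_edge_def)
  then show ?thesis by linarith
qed

lemma nonedges_edgeless_graph:
  "nonedges (edgeless_graph n) = {{u, v} | u v. u < n \<and> v < n \<and> u \<noteq> v}"
  unfolding nonedges_def edge_set_edgeless_graph by (simp add: edgeless_graph_def)

theorem proposition1:
  fixes n :: nat
  shows "chi_unfrozen (edgeless_graph n) \<longleftrightarrow> n \<in> {0, 1}"
proof
  assume unfrozen: "chi_unfrozen (edgeless_graph n)"
  show "n \<in> {0, 1}"
  proof (rule ccontr)
    assume "n \<notin> {0, 1}"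
    then have "0 < n" "1 < n" by auto
    then have e: "{0, 1} \<in> nonedges (edgeless_graph n)"
      unfolding nonedges_edgeless_graph by (intro CollectI exI[of _ 0] exI[of _ 1]) simp
    then have "chromatic_number (add_edge (edgeless_graph n) {0, 1}) \<le> 1"
      using unfrozen chromatic_number_edgeless_graph_le by (simp add: chi_unfrozen_def)
    with chromatic_number_add_edge_ge[OF pair_graph_edgeless_graph e] show False by linarith
  qed
next
  assume "n \<in> {0, 1}"
  \<comment> \<open>No two distinct naturals lie below 1.\<close>
  then have "nonedges (edgeless_graph n) = {}"
    by (auto simp: nonedges_edgeless_graph)
  then show "chi_unfrozen (edgeless_graph n)" by (simp add: chi_unfrozen_def)
qed

end
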